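(* Let $X$ be a graph. Then $\mathrm{sep}_X(n)/n\not\to 0$ as $n\to\infty$ if and only if $X$ contains an expander as a subgraph, i.e. there exist $\varepsilon>0$ and an $\varepsilon$-expander $\bigcup_{n\in\mathbb{N}}\Gamma_n$ such that every $\Gamma_n$ is a subgraph of $X$.
   Context: Graphs are simple and undirected; $|\Gamma|$ is the number of vertices of $\Gamma$. For a finite graph $\Gamma$ with $n\ge 2$ vertices and $A\subseteq V(\Gamma)$, the vertex boundary $\partial A$ is the set of vertices of $V(\Gamma)\setminus A$ having a neighbour in $A$, and the (vertex) Cheeger constant is $h(\Gamma)=\min\{|\partial A|/|A| : \emptyset\neq A\subseteq V(\Gamma),\ |A|\le n/2\}$. An $\varepsilon$-expander is an infinite union $\bigcup_{n\in\mathbb{N}}\Gamma_n$ of distinct (pairwise non-isomorphic) finite graphs $\Gamma_n$, each with at least two vertices, with $h(\Gamma_n)\ge\varepsilon>0$ for all $n$. When the $\Gamma_n$ are subgraphs of a given graph $X$ they are not required to be disjoint in $X$. No bound on degrees is assumed. For a finite graph $\Gamma$ with $n$ vertices, the cut size $\mathrm{cut}(\Gamma)$ is the minimal cardinality of a set $S$ of vertices such that every connected component of $\Gamma\setminus S$ has at most $n/2$ vertices. The separation profile of a graph $X$ is the function $\mathrm{sep}_X$ on $\mathbb{N}$ where $\mathrm{sep}_X(n)$ is the maximum of $\mathrm{cut}(\Gamma)$ over all subgraphs $\Gamma$ of $X$ with at most $n$ vertices. *)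

theory Defs
  imports Complex_Main "Graph_Theory.Graph_Theory"
begin

(* A simple undirected graph, possibly infinite, is a symmetric loop-free relation on its
   vertex set: pair_bidirected_digraph.  Its finite version is pair_graph. *)

definition vertex_boundary :: "'a pair_pre_digraph \<Rightarrow> 'a set \<Rightarrow> 'a set" where
  "vertex_boundary \<Gamma> A = {v \<in> pverts \<Gamma> - A. \<exists>u\<in>A. (u, v) \<in> parcs \<Gamma>}"

(* Meaningful for finite graphs with at least two vertices; otherwise Min may range over an
   empty or infinite set. *)
definition cheeger :: "'a pair_pre_digraph \<Rightarrow> real" where
  "cheeger \<Gamma> = Min {real (card (vertex_boundary \<Gamma> A)) / real (card A) | A.
     A \<noteq> {} \<and> A \<subseteq> pverts \<Gamma> \<and> real (card A) \<le> real (card (pverts \<Gamma>)) / 2}"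

(* The graphs are not required to be disjoint. *)
definition expander :: "real \<Rightarrow> (nat \<Rightarrow> 'a pair_pre_digraph) \<Rightarrow> bool" where
  "expander \<epsilon> \<Gamma> \<longleftrightarrow> \<epsilon> > 0 \<and>
     (\<forall>n. pair_graph (\<Gamma> n) \<and> card (pverts (\<Gamma> n)) \<ge> 2 \<and> cheeger (\<Gamma> n) \<ge> \<epsilon>) \<and>
     (\<forall>m n. m \<noteq> n \<longrightarrow> \<not> digraph_iso (with_proj (\<Gamma> m)) (with_proj (\<Gamma> n)))"

(* Reachability in a symmetric digraph is symmetric, so the strongly connected components
   are exactly the connected components of the undirected graph. *)
definition graph_components :: "('a, 'b) pre_digraph \<Rightarrow> ('a, 'b) pre_digraph set" where
  "graph_components G = pre_digraph.sccs G"

definition cut_size :: "'a pair_pre_digraph \<Rightarrow> nat" where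
  "cut_size \<Gamma> = Min {card S | S. S \<subseteq> pverts \<Gamma> \<and>
     (\<forall>C \<in> graph_components (with_proj \<Gamma> \<restriction> (pverts \<Gamma> - S)).
        real (card (verts C)) \<le> real (card (pverts \<Gamma>)) / 2)}"

(* The empty subgraph has cut size 0, and cut_size \<Gamma> is at most the number of vertices of \<Gamma>, so
   Max ranges over a nonempty subset of {0..n} even when X is infinite. *)
definition sep_profile :: "'a pair_pre_digraph \<Rightarrow> nat \<Rightarrow> nat" where
  "sep_profile X n = Max {cut_size \<Gamma> | \<Gamma>.
     pair_graph \<Gamma> \<and> subgraph (with_proj \<Gamma>) (with_proj X) \<and> card (pverts \<Gamma>) \<le> n}"

end

theory Submission
  imports Defs
begin

text \<open>
  If a separator \<open>S\<close> of \<open>\<Gamma>\<close> has fewer than \<open>3n/4\<close> vertices, some union \<open>A\<close> of components of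
  \<open>\<Gamma> - S\<close> has between \<open>n/4\<close> and \<open>n/2\<close> vertices and boundary inside \<open>S\<close>, so expansion bounds
  \<open>|S|\<close> below linearly; pairwise non-isomorphic graphs have unbounded size, so this happens at
  arbitrarily large scales. Conversely, if no induced subgraph of \<open>\<Gamma>\<close> with more than \<open>n/2\<close>
  vertices has Cheeger constant at least \<open>\<epsilon>\<close>, repeatedly removing a set with small boundary
  together with that boundary, until at most \<open>n/2\<close> vertices remain, yields a separator with at
  most \<open>\<epsilon>n\<close> vertices. Hence linear cuts force large expanding subgraphs.
\<close>

section \<open>Vertex boundary and Cheeger constant as an attained minimum\<close>

lemma vertex_boundary_eq:
  "vertex_boundary \<Gamma> A = (parcs \<Gamma> `` A \<inter> pverts \<Gamma>) - A"
  unfolding vertex_boundary_def by blast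

lemma cheeger_set_finite:
  assumes "finite (pverts \<Gamma>)"
  shows "finite {real (card (vertex_boundary \<Gamma> A)) / real (card A) | A.
     A \<noteq> {} \<and> A \<subseteq> pverts \<Gamma> \<and> real (card A) \<le> real (card (pverts \<Gamma>)) / 2}"
proof -
  have "finite ((\<lambda>A. real (card (vertex_boundary \<Gamma> A)) / real (card A)) ` Pow (pverts \<Gamma>))"
    using assms by simp
  then show ?thesis by (rule rev_finite_subset) auto
qed

lemma cheeger_le:
  assumes "finite (pverts \<Gamma>)" "A \<noteq> {}" "A \<subseteq> pverts \<Gamma>"
    and "real (card A) \<le> real (card (pverts \<Gamma>)) / 2"
  shows "cheeger \<Gamma> \<le> real (card (vertex_boundary \<Gamma> A)) / real (card A)"
  unfolding cheeger_def
  by (rule Min_le[OF cheeger_set_finite[OF assms(1)]]) (use assms in blast)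

lemma cheeger_attained:
  assumes "finite (pverts \<Gamma>)" "card (pverts \<Gamma>) \<ge> 2"
  obtains A where "A \<noteq> {}" "A \<subseteq> pverts \<Gamma>" "real (card A) \<le> real (card (pverts \<Gamma>)) / 2"
    and "cheeger \<Gamma> = real (card (vertex_boundary \<Gamma> A)) / real (card A)"
proof -
  let ?C = "{real (card (vertex_boundary \<Gamma> A)) / real (card A) | A.
     A \<noteq> {} \<and> A \<subseteq> pverts \<Gamma> \<and> real (card A) \<le> real (card (pverts \<Gamma>)) / 2}"
  \<comment> \<open>With at least two vertices, a singleton satisfies the size bound n/2, so the
    minimum ranges over a nonempty set.\<close>
  obtain v where "v \<in> pverts \<Gamma>" using assms by fastforce
  then have "real (card (vertex_boundary \<Gamma> {v})) / real (card {v}) \<in> ?C"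
    using assms by (intro CollectI exI[of _ "{v}"]) auto
  then have "Min ?C \<in> ?C"
    using Min_in[OF cheeger_set_finite[OF assms(1)]] by blast
  then show thesis using that unfolding cheeger_def by blast
qed

section \<open>Separators and the cut size\<close>

abbreviation separates :: "'a pair_pre_digraph \<Rightarrow> 'a set \<Rightarrow> bool" where
  "separates \<Gamma> S \<equiv> \<forall>C \<in> graph_components (with_proj \<Gamma> \<restriction> (pverts \<Gamma> - S)).
        real (card (verts C)) \<le> real (card (pverts \<Gamma>)) / 2"

lemma cut_set_finite:
  assumes "finite (pverts \<Gamma>)"
  shows "finite {card S | S. S \<subseteq> pverts \<Gamma> \<and> separates \<Gamma> S}"
proof -
  have "finite (card ` Pow (pverts \<Gamma>))" using assms by simp
  then show ?thesis by (rule rev_finite_subset) auto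
qed

lemma cut_size_le:
  assumes "finite (pverts \<Gamma>)" "S \<subseteq> pverts \<Gamma>" "separates \<Gamma> S"
  shows "cut_size \<Gamma> \<le> card S"
  unfolding cut_size_def
  by (rule Min_le[OF cut_set_finite[OF assms(1)]]) (use assms in blast)

text \<open>Deleting every vertex leaves no component, because strong connectivity demands a vertex.
  This keeps the set under \<open>Min\<close> in \<open>cut_size\<close> nonempty.\<close>

lemma separates_verts: "separates \<Gamma> (pverts \<Gamma>)"
  by (auto simp: graph_components_def pre_digraph.sccs_def strongly_connected_def
      induced_subgraph_def subgraph_def)

lemma cut_size_le_card:
  assumes "finite (pverts \<Gamma>)"
  shows "cut_size \<Gamma> \<le> card (pverts \<Gamma>)"
  using cut_size_le[OF assms subset_refl separates_verts] .

lemma cut_size_attained: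
  assumes "finite (pverts \<Gamma>)"
  obtains S where "S \<subseteq> pverts \<Gamma>" "separates \<Gamma> S" "cut_size \<Gamma> = card S"
proof -
  have "{card S | S. S \<subseteq> pverts \<Gamma> \<and> separates \<Gamma> S} \<noteq> {}"
    using separates_verts by blast
  from Min_in[OF cut_set_finite[OF assms] this] show thesis
    using that unfolding cut_size_def by blast
qed

section \<open>The separation profile as an attained maximum\<close>

lemma sep_set_finite:
  "finite {cut_size \<Gamma> | \<Gamma>.
     pair_graph \<Gamma> \<and> subgraph (with_proj \<Gamma>) (with_proj X) \<and> card (pverts \<Gamma>) \<le> n}"
proof (rule finite_subset[of _ "{..n}"])
  show "{cut_size \<Gamma> | \<Gamma>. pair_graph \<Gamma> \<and> subgraph (with_proj \<Gamma>) (with_proj X) \<and> card (pverts \<Gamma>) \<le> n}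
    \<subseteq> {..n}"
    using cut_size_le_card pair_fin_digraph.pair_finite_verts
    by (fastforce simp: pair_graph_def pair_digraph_def intro: order_trans)
qed simp

lemma cut_size_le_sep_profile:
  assumes "pair_graph \<Gamma>" "subgraph (with_proj \<Gamma>) (with_proj X)" "card (pverts \<Gamma>) \<le> n"
  shows "cut_size \<Gamma> \<le> sep_profile X n"
  unfolding sep_profile_def by (rule Max_ge[OF sep_set_finite]) (use assms in blast)

lemma sep_profile_attained:
  assumes "pair_wf_digraph X"
  obtains \<Gamma> where "pair_graph \<Gamma>" "subgraph (with_proj \<Gamma>) (with_proj X)" "card (pverts \<Gamma>) \<le> n"
    and "sep_profile X n = cut_size \<Gamma>"
proof -
  let ?E = "\<lparr>pverts = {}, parcs = {}\<rparr> :: 'a pair_pre_digraph"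
  have "pair_graph ?E"
    by unfold_locales (auto simp: symmetric_def arcs_ends_def sym_def)
  moreover have "subgraph (with_proj ?E) (with_proj X)"
    using assms by (auto simp: subgraph_def wf_digraph_wp_iff compatible_def pair_wf_digraph_def)
  ultimately have "{cut_size \<Gamma> | \<Gamma>. pair_graph \<Gamma> \<and> subgraph (with_proj \<Gamma>) (with_proj X)
      \<and> card (pverts \<Gamma>) \<le> n} \<noteq> {}"
    by fastforce
  from Max_in[OF sep_set_finite this] show thesis
    using that unfolding sep_profile_def by blast
qed

section \<open>Connected components and arc-closed vertex sets\<close>

lemma reachable_closed:
  assumes "u \<rightarrow>\<^sup>*\<^bsub>G\<^esub> v" "u \<in> B" "arcs_ends G `` B \<subseteq> B"
  shows "v \<in> B"
  using assms unfolding reachable_def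
  by (induction rule: rtrancl_on_induct) auto

lemma arcs_ends_induce:
  "arcs_ends (with_proj \<Gamma> \<restriction> W) = Restr (parcs \<Gamma>) W"
  by (auto simp: arcs_ends_def arc_to_ends_def image_def)

text \<open>A connected component cannot leave an arc-closed set that it meets, so it lies inside
  the set \<open>B\<close> of any of its vertices. Separators can thus be certified by closed sets,
  without computing components.\<close>

lemma separates_if_closed_sets:
  assumes fin: "finite (pverts \<Gamma>)"
    and B: "\<forall>v \<in> pverts \<Gamma> - S. \<exists>B \<subseteq> pverts \<Gamma> - S. v \<in> B
      \<and> real (card B) \<le> real (card (pverts \<Gamma>)) / 2 \<and> parcs \<Gamma> `` B \<inter> (pverts \<Gamma> - S) \<subseteq> B"
  shows "separates \<Gamma> S"
proof
  fix C assume "C \<in> graph_components (with_proj \<Gamma> \<restriction> (pverts \<Gamma> - S))"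
  then have C: "induced_subgraph C (with_proj \<Gamma> \<restriction> (pverts \<Gamma> - S))" "strongly_connected C"
    by (auto simp: graph_components_def pre_digraph.sccs_def)
  then have vC: "verts C \<subseteq> pverts \<Gamma> - S" and
    aC: "arcs_ends C \<subseteq> arcs_ends (with_proj \<Gamma> \<restriction> (pverts \<Gamma> - S))"
    by (auto simp: induced_subgraph_def subgraph_def compatible_def arcs_ends_def arc_to_ends_def)
  obtain v where v: "v \<in> verts C" using C(2) by (auto simp: strongly_connected_def)
  obtain B where B': "B \<subseteq> pverts \<Gamma> - S" "v \<in> B" "real (card B) \<le> real (card (pverts \<Gamma>)) / 2"
    "parcs \<Gamma> `` B \<inter> (pverts \<Gamma> - S) \<subseteq> B"
    using bspec[OF B subsetD[OF vC v]] by (elim exE conjE) rule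
  have "arcs_ends C `` B \<subseteq> B" using aC B' unfolding arcs_ends_induce by blast
  then have "verts C \<subseteq> B"
    using C(2) v reachable_closed[where G = C] B'(2) unfolding strongly_connected_def by blast
  then have "card (verts C) \<le> card B"
    using B'(1) fin by (meson card_mono finite_Diff finite_subset)
  with B'(3) show "real (card (verts C)) \<le> real (card (pverts \<Gamma>)) / 2" by linarith
qed

text \<open>The family consists of the classes of mutual reachability. Strong components of a
  general digraph need not be closed under outgoing arcs; here they are, since by symmetry each arc
  can be traversed back.\<close>

lemma components_partition:
  assumes "pair_graph \<Gamma>" "W \<subseteq> pverts \<Gamma>"
  obtains \<C> where "finite \<C>" "\<Union>\<C> = W"
    "\<And>C. C \<in> \<C> \<Longrightarrow> parcs \<Gamma> `` C \<inter> W \<subseteq> C"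
    "\<And>C. C \<in> \<C> \<Longrightarrow> \<exists>H \<in> graph_components (with_proj \<Gamma> \<restriction> W). C = verts H"
proof -
  interpret pair_graph \<Gamma> by fact
  let ?G = "with_proj \<Gamma> \<restriction> W"
  have "wf_digraph ?G" using assms(2) by (intro wellformed_induce_subgraph)
  then interpret G: wf_digraph ?G .
  have "finite W" using assms(2) pair_finite_verts finite_subset by blast
  have sym: "(v, u) \<in> arcs_ends ?G" if "(u, v) \<in> arcs_ends ?G" for u v
    using that arcs_symmetric unfolding arcs_ends_induce by auto
  show thesis
  proof
    show "finite (G.scc_of ` W)" using \<open>finite W\<close> by simp
    show "\<Union>(G.scc_of ` W) = W"
      using G.in_scc_of_self G.reachable_in_verts by (auto simp: G.scc_of_def)
    fix C assume "C \<in> G.scc_of ` W"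
    then obtain w where w: "w \<in> W" "C = G.scc_of w" by blast
    show "\<exists>H \<in> graph_components ?G. C = verts H"
      using G.scc_of_in_sccs_verts[of w] w unfolding graph_components_def G.sccs_verts_conv
      by auto
    show "parcs \<Gamma> `` C \<inter> W \<subseteq> C"
    proof
      fix v assume "v \<in> parcs \<Gamma> `` C \<inter> W"
      then obtain u where u: "u \<in> C" "(u, v) \<in> parcs \<Gamma>" "v \<in> W" by blast
      have "u \<in> W" using u(1) w G.reachable_in_verts by (auto simp: G.scc_of_def)
      then have "(u, v) \<in> arcs_ends ?G" using u unfolding arcs_ends_induce by blast
      then show "v \<in> C" using u(1) w sym
        by (auto simp: G.scc_of_def intro: G.reachable_adj_trans G.adj_reachable_trans)
    qed
  qed
qed

section \<open>Expansion forces linear cuts\<close>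

lemma medium_union:
  fixes t :: real
  assumes "finite \<C>" "0 \<le> t" "\<And>C. C \<in> \<C> \<Longrightarrow> real (card C) \<le> t" "t / 2 \<le> real (card (\<Union>\<C>))"
  shows "\<exists>\<F> \<subseteq> \<C>. t / 2 \<le> real (card (\<Union>\<F>)) \<and> real (card (\<Union>\<F>)) \<le> t"
  using assms
proof (induction \<C> rule: finite_induct)
  case empty
  then show ?case by auto
next
  case (insert C \<C>)
  \<comment> \<open>Greedy choice: if the earlier sets already reach \<open>t / 2\<close>, recurse
    on them; if \<open>C\<close> alone does, take \<open>C\<close>. Otherwise both stay below
    \<open>t / 2\<close>, so the whole union stays below \<open>t\<close>, and it reaches
    \<open>t / 2\<close> by assumption.\<close>
  consider "t / 2 \<le> card (\<Union>\<C>)" | "t / 2 \<le> card C" | "card (\<Union>\<C>) < t / 2" "card C < t / 2"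
    by linarith
  then show ?case
  proof cases
    case 1
    with insert have "\<exists>\<F> \<subseteq> \<C>. t / 2 \<le> real (card (\<Union>\<F>)) \<and> real (card (\<Union>\<F>)) \<le> t"
      by simp
    then show ?thesis by (meson subset_insertI2)
  next
    case 2
    then show ?thesis using insert.prems(2)[of C] by (intro exI[of _ "{C}"]) auto
  next
    case 3
    have "card (\<Union>(insert C \<C>)) \<le> card C + card (\<Union>\<C>)"
      using card_Un_le[of C "\<Union>\<C>"] by simp
    with 3 insert.prems(3) show ?thesis by (intro exI[of _ "insert C \<C>"]) auto
  qed
qed

text \<open>The constant covers two cases. A separator with at least 3/4 of the vertices is linear
  already. Otherwise more than n/4 vertices survive, and a union of components with at least n/4
  vertices has its boundary in the separator, which gives \<open>\<epsilon>/4\<close>.\<close>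

lemma cut_size_ge_cheeger:
  assumes "pair_graph \<Gamma>" "card (pverts \<Gamma>) \<ge> 2" "cheeger \<Gamma> \<ge> \<epsilon>" "\<epsilon> > 0"
  shows "real (cut_size \<Gamma>) \<ge> min (3/4) (\<epsilon>/4) * real (card (pverts \<Gamma>))"
proof -
  interpret pair_graph \<Gamma> by fact
  let ?V = "pverts \<Gamma>" and ?n = "real (card (pverts \<Gamma>))"
  have fin: "finite ?V" by (rule pair_finite_verts)
  obtain S where S: "S \<subseteq> ?V" "separates \<Gamma> S" "cut_size \<Gamma> = card S"
    using cut_size_attained[OF fin] .
  have finS: "finite S" using S(1) fin finite_subset by blast
  show ?thesis
  proof (cases "real (card S) \<ge> 3/4 * ?n")
    case True
    have "min (3/4) (\<epsilon>/4) * ?n \<le> 3/4 * ?n" by (intro mult_right_mono) auto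
    with True S(3) show ?thesis by linarith
  next
    case False
    obtain \<C> where C: "finite \<C>" "\<Union>\<C> = ?V - S"
      "\<And>C. C \<in> \<C> \<Longrightarrow> parcs \<Gamma> `` C \<inter> (?V - S) \<subseteq> C"
      "\<And>C. C \<in> \<C> \<Longrightarrow> \<exists>H \<in> graph_components (with_proj \<Gamma> \<restriction> (?V - S)). C = verts H"
      using components_partition[OF assms(1), of "?V - S"] by auto
    have small: "real (card C) \<le> ?n / 2" if "C \<in> \<C>" for C
      using C(4)[OF that] S(2) by blast
    have "card (?V - S) + card S = card ?V"
      using S(1) fin finS card_mono[OF fin S(1)] by (simp add: card_Diff_subset)
    \<comment> \<open>\<open>medium_union\<close> is applied with t = n/2, the bound on each
      component; its requirement t/2 = n/4 is what survives outside \<open>S\<close>.\<close>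
    with False have "?n / 2 / 2 \<le> real (card (\<Union>\<C>))" unfolding C(2) by linarith
    from medium_union[OF C(1) _ small this] obtain \<F> where F: "\<F> \<subseteq> \<C>"
      "?n / 2 / 2 \<le> real (card (\<Union>\<F>))" "real (card (\<Union>\<F>)) \<le> ?n / 2" by auto
    have A: "\<Union>\<F> \<subseteq> ?V - S" using F(1) C(2) by blast
    have pos: "card (\<Union>\<F>) > 0" using F(2) assms(2) by linarith
    then have "\<Union>\<F> \<noteq> {}" by (metis card.empty less_irrefl)
    then have "\<epsilon> \<le> real (card (vertex_boundary \<Gamma> (\<Union>\<F>))) / real (card (\<Union>\<F>))"
      using cheeger_le[OF fin, of "\<Union>\<F>"] A F(3) assms(3) by force
    then have "\<epsilon> * real (card (\<Union>\<F>)) \<le> real (card (vertex_boundary \<Gamma> (\<Union>\<F>)))"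
      using pos by (simp add: field_simps)
    \<comment> \<open>A union of components is closed under arcs inside the complement of
      \<open>S\<close>, so any neighbour outside it lies in \<open>S\<close>.\<close>
    moreover have "vertex_boundary \<Gamma> (\<Union>\<F>) \<subseteq> S"
      using C(3) F(1) unfolding vertex_boundary_eq by blast
    then have "card (vertex_boundary \<Gamma> (\<Union>\<F>)) \<le> card S" using finS card_mono by blast
    moreover have "\<epsilon> * (?n / 2 / 2) \<le> \<epsilon> * real (card (\<Union>\<F>))"
      using F(2) assms(4) by (intro mult_left_mono) auto
    moreover have "min (3/4) (\<epsilon>/4) * ?n \<le> \<epsilon>/4 * ?n" by (intro mult_right_mono) auto
    ultimately show ?thesis using S(3) by (simp add: field_simps)
  qed
qed

section \<open>Peeling: large cuts force large expanding subgraphs\<close>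

lemma small_separator:
  fixes E :: "'a rel" and t \<epsilon> :: real
  assumes "sym E" "finite W" "\<epsilon> \<ge> 0"
    and "\<And>U. U \<subseteq> W \<Longrightarrow> real (card U) > t \<Longrightarrow> \<exists>A \<subseteq> U. A \<noteq> {} \<and> real (card A) \<le> t
      \<and> real (card ((E `` A \<inter> U) - A)) \<le> \<epsilon> * real (card A)"
  shows "\<exists>S \<subseteq> W. real (card S) \<le> \<epsilon> * real (card W)
    \<and> (\<forall>v \<in> W - S. \<exists>B \<subseteq> W - S. v \<in> B \<and> real (card B) \<le> t \<and> E `` B \<inter> (W - S) \<subseteq> B)"
  \<comment> \<open>The threshold \<open>t\<close> stays fixed while \<open>W\<close> shrinks. The
    peeling hypothesis speaks of all large subsets of \<open>W\<close>, so it passes to the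
    remainder.\<close>
  using assms(2,4)
proof (induction W rule: finite_psubset_induct)
  case (psubset W)
  show ?case
  proof (cases "real (card W) > t")
    case False
    \<comment> \<open>Nothing is removed: \<open>W\<close> itself is a small closed set.\<close>
    then show ?thesis using assms(3) by (intro exI[of _ "{}"]) auto
  next
    case True
    then obtain A where A: "A \<subseteq> W" "A \<noteq> {}" "real (card A) \<le> t"
      "real (card ((E `` A \<inter> W) - A)) \<le> \<epsilon> * real (card A)"
      using psubset.prems[of W] by blast
    \<comment> \<open>\<open>A\<close> becomes a finished block, its boundary \<open>D\<close>
      within \<open>W\<close> goes into the separator, and the induction continues on
      \<open>U\<close>.\<close>
    define D where "D = (E `` A \<inter> W) - A"
    define U where "U = W - (A \<union> D)"
    have fin: "finite A" "finite D" "finite U"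
      using A(1) psubset.hyps by (auto simp: D_def U_def intro: finite_subset)
    have "U \<subset> W" using A unfolding U_def by blast
    then obtain S where S: "S \<subseteq> U" "real (card S) \<le> \<epsilon> * real (card U)"
      "\<forall>v \<in> U - S. \<exists>B \<subseteq> U - S. v \<in> B \<and> real (card B) \<le> t \<and> E `` B \<inter> (U - S) \<subseteq> B"
      using psubset.IH[of U, OF _ psubset.prems] by (blast dest: psubset_imp_subset)
    have rest: "W - (S \<union> D) = A \<union> (U - S)"
      using A(1) S(1) unfolding U_def D_def by blast
    \<comment> \<open>Neighbours of \<open>A\<close> in \<open>W\<close> outside \<open>A\<close>
      all lie in \<open>D\<close>, so none lie in \<open>U\<close>; symmetry of the relation gives
      the other direction. Hence the blocks found inside \<open>U\<close> stay closed once
      \<open>A\<close> is put back.\<close>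
    have cross: "E `` A \<inter> U = {}" "E `` U \<inter> A = {}"
      using \<open>sym E\<close> unfolding U_def D_def by (auto dest: symD)
    show ?thesis
    proof (rule exI[of _ "S \<union> D"], intro conjI ballI)
      show "S \<union> D \<subseteq> W" using S(1) unfolding U_def D_def by blast
      \<comment> \<open>Each deleted boundary is charged to the set peeled off with it. These sets
        are disjoint from the remainder, so the charges add up to at most \<open>\<epsilon>\<close>
        times the size of \<open>W\<close>.\<close>
      have "A \<inter> U = {}" "A \<union> U \<subseteq> W" using A(1) unfolding U_def by blast+
      then have "card A + card U \<le> card W"
        using card_Un_disjoint[OF fin(1,3)] card_mono[OF psubset.hyps] by metis
      then have "\<epsilon> * (real (card A) + real (card U)) \<le> \<epsilon> * real (card W)"
        using assms(3) by (intro mult_left_mono) auto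
      moreover have "real (card (S \<union> D)) \<le> real (card S) + real (card D)"
        using card_Un_le[of S D] by linarith
      ultimately show "real (card (S \<union> D)) \<le> \<epsilon> * real (card W)"
        using S(2) A(4) unfolding D_def by (simp add: distrib_left)
    next
      fix v assume "v \<in> W - (S \<union> D)"
      then consider "v \<in> A" | "v \<in> U - S" unfolding rest by blast
      then show "\<exists>B \<subseteq> W - (S \<union> D). v \<in> B \<and> real (card B) \<le> t \<and> E `` B \<inter> (W - (S \<union> D)) \<subseteq> B"
      proof cases
        case 1
        then show ?thesis using A(3) cross(1) unfolding rest by (intro exI[of _ A]) blast
      next
        case 2
        from bspec[OF S(3) 2] obtain B where B: "B \<subseteq> U - S" "v \<in> B" "real (card B) \<le> t" "E `` B \<inter> (U - S) \<subseteq> B"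
          by (elim exE conjE) rule
        have "E `` B \<inter> A = {}" using B(1) cross(2) by blast
        then have "E `` B \<inter> (A \<union> (U - S)) \<subseteq> B" using B(4) by blast
        then show ?thesis using B unfolding rest by (intro exI[of _ B]) auto
      qed
    qed
  qed
qed

lemma pair_graph_restrict:
  assumes "pair_graph \<Gamma>" "U \<subseteq> pverts \<Gamma>"
  shows "pair_graph \<lparr>pverts = U, parcs = Restr (parcs \<Gamma>) U\<rparr>"
    and "subgraph (with_proj \<lparr>pverts = U, parcs = Restr (parcs \<Gamma>) U\<rparr>) (with_proj \<Gamma>)"
proof -
  interpret pair_graph \<Gamma> by fact
  show G: "pair_graph \<lparr>pverts = U, parcs = Restr (parcs \<Gamma>) U\<rparr>"
    using assms(2) pair_finite_verts pair_finite_arcs pair_no_loops arcs_symmetric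
    by unfold_locales (auto simp: symmetric_def sym_def intro: finite_subset)
  interpret U: pair_graph "\<lparr>pverts = U, parcs = Restr (parcs \<Gamma>) U\<rparr>" by fact
  show "subgraph (with_proj \<lparr>pverts = U, parcs = Restr (parcs \<Gamma>) U\<rparr>) (with_proj \<Gamma>)"
    using assms(2) wf_digraph_axioms U.wf_digraph_axioms by (auto simp: subgraph_def)
qed

text \<open>The contrapositive of peeling with t = n/2: if no induced subgraph on more than n/2
  vertices had Cheeger constant at least \<open>\<epsilon>\<close>, \<open>small_separator\<close>
  would produce a separator too small for the assumed cut size.\<close>

lemma expander_subgraph_if_large_cut:
  assumes "pair_graph \<Gamma>" "card (pverts \<Gamma>) \<ge> 2" "\<epsilon> \<ge> 0"
    and cut: "real (cut_size \<Gamma>) > \<epsilon> * real (card (pverts \<Gamma>))"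
  obtains \<Gamma>' where "pair_graph \<Gamma>'" "subgraph (with_proj \<Gamma>') (with_proj \<Gamma>)"
    "real (card (pverts \<Gamma>')) > real (card (pverts \<Gamma>)) / 2" "cheeger \<Gamma>' \<ge> \<epsilon>"
proof -
  interpret pair_graph \<Gamma> by fact
  let ?V = "pverts \<Gamma>" and ?E = "parcs \<Gamma>" and ?t = "real (card (pverts \<Gamma>)) / 2"
  let ?H = "\<lambda>U. \<lparr>pverts = U, parcs = Restr (parcs \<Gamma>) U\<rparr>"
  have fin: "finite ?V" by (rule pair_finite_verts)
  have "\<exists>U \<subseteq> ?V. real (card U) > ?t \<and> cheeger (?H U) \<ge> \<epsilon>"
  proof (rule ccontr)
    assume neg: "\<not> ?thesis"
    have peel: "\<exists>A \<subseteq> U. A \<noteq> {} \<and> real (card A) \<le> ?t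
      \<and> real (card ((?E `` A \<inter> U) - A)) \<le> \<epsilon> * real (card A)"
      if U: "U \<subseteq> ?V" "real (card U) > ?t" for U
    proof -
      have finU: "finite U" using U(1) fin finite_subset by blast
      \<comment> \<open>More than n/2 vertices with n at least 2 means at least two, as
        \<open>cheeger_attained\<close> requires.\<close>
      have "card U \<ge> 2" using U(2) assms(2) by linarith
      then obtain A where A: "A \<noteq> {}" "A \<subseteq> U" "real (card A) \<le> real (card U) / 2"
        "cheeger (?H U) = real (card (vertex_boundary (?H U) A)) / real (card A)"
        using cheeger_attained[of "?H U"] finU by auto
      have "card A > 0" using A(1,2) finU finite_subset by (metis card_gt_0_iff)
      moreover have "cheeger (?H U) < \<epsilon>" using neg U by force
      ultimately have "real (card (vertex_boundary (?H U) A)) \<le> \<epsilon> * real (card A)"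
        using A(4) by (simp add: field_simps)
      moreover have "vertex_boundary (?H U) A = (?E `` A \<inter> U) - A"
        using A(2) unfolding vertex_boundary_eq by auto
      \<comment> \<open>The minimizer has at most half the vertices of \<open>U\<close>, hence at
        most half those of \<open>\<Gamma>\<close>, so it meets the fixed threshold.\<close>
      moreover have "card U \<le> card ?V" using U(1) fin card_mono by blast
      ultimately show ?thesis using A by (intro exI[of _ A]) auto
    qed
    have "sym ?E" using arcs_symmetric by (auto intro: symI)
    from small_separator[OF this fin assms(3) peel] obtain S where S:
      "S \<subseteq> ?V" "real (card S) \<le> \<epsilon> * real (card ?V)"
      "\<forall>v \<in> ?V - S. \<exists>B \<subseteq> ?V - S. v \<in> B \<and> real (card B) \<le> ?t \<and> ?E `` B \<inter> (?V - S) \<subseteq> B"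
      by blast
    have "cut_size \<Gamma> \<le> card S"
      by (rule cut_size_le[OF fin S(1) separates_if_closed_sets[OF fin S(3)]])
    with S(2) cut show False by linarith
  qed
  then obtain U where U: "U \<subseteq> ?V" "real (card U) > ?t" "cheeger (?H U) \<ge> \<epsilon>" by blast
  show thesis
    by (rule that[OF pair_graph_restrict[OF assms(1) U(1)]]) (use U in simp_all)
qed

section \<open>Isomorphism and the number of vertices\<close>

lemma digraph_iso_card_verts:
  assumes "digraph_iso G H"
  shows "card (verts G) = card (verts H)"
  using assms by (auto simp: digraph_iso_def pre_digraph.digraph_isomorphism_def card_image)

text \<open>If two injective labellings produce the same labelled graph, following one by the
  inverse of the other is an isomorphism. This reduces isomorphism of abstract graphs to equality of
  concrete codes.\<close>

lemma digraph_iso_with_proj: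
  assumes wf: "pair_wf_digraph G" "pair_wf_digraph H"
    and g: "inj_on g (pverts G)" and h: "inj_on h (pverts H)"
    and V: "g ` pverts G = h ` pverts H"
    and E: "map_prod g g ` parcs G = map_prod h h ` parcs H"
  shows "digraph_iso (with_proj G) (with_proj H)"
proof -
  interpret G: pair_wf_digraph G by fact
  interpret H: pair_wf_digraph H by fact
  define f where "f = the_inv_into (pverts H) h \<circ> g"
  have hf: "f u \<in> pverts H \<and> h (f u) = g u" if "u \<in> pverts G" for u
    using that h unfolding f_def
    by (simp add: f_the_inv_into_f the_inv_into_into flip: V)
  have fh: "f u = v" if "u \<in> pverts G" "v \<in> pverts H" "g u = h v" for u v
    using that hf[of u] inj_onD[OF h, of "f u" v] by simp
  have inj: "inj_on f (pverts G)"
  proof (rule inj_onI)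
    fix u v assume "u \<in> pverts G" "v \<in> pverts G" "f u = f v"
    with hf[of u] hf[of v] inj_onD[OF g] show "u = v" by simp
  qed
  have fV: "f ` pverts G = pverts H"
  proof (intro subset_antisym image_subsetI subsetI)
    fix v assume v: "v \<in> pverts H"
    then have "h v \<in> g ` pverts G" using V by simp
    then obtain u where "u \<in> pverts G" "g u = h v" by auto
    with fh[OF _ v] show "v \<in> f ` pverts G" by blast
  qed (use hf in blast)
  have fE: "map_prod f f ` parcs G = parcs H"
  proof (intro set_eqI iffI)
    fix e assume "e \<in> map_prod f f ` parcs G"
    then obtain u v where uv: "(u, v) \<in> parcs G" "e = (f u, f v)" by auto
    then have "(g u, g v) \<in> map_prod h h ` parcs H" using E by force
    then obtain x y where xy: "(x, y) \<in> parcs H" "g u = h x" "g v = h y" by auto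
    then show "e \<in> parcs H"
      using uv fh[of u x] fh[of v y] G.wellformed'[OF uv(1)] H.wellformed'[OF xy(1)] by simp
  next
    fix e assume e: "e \<in> parcs H"
    obtain x y where xy: "e = (x, y)" by (cases e) auto
    then have "(h x, h y) \<in> map_prod g g ` parcs G" using E e by force
    then obtain u v where uv: "(u, v) \<in> parcs G" "g u = h x" "g v = h y" by auto
    then have "e = (f u, f v)"
      using xy fh[of u x] fh[of v y] G.wellformed'[OF uv(1)] H.wellformed'[OF e[unfolded xy]]
      by simp
    then show "e \<in> map_prod f f ` parcs G" using uv(1) by force
  qed
  have "inj_on (map_prod f f) (parcs G)"
    by (rule inj_on_subset[OF map_prod_inj_on[OF inj inj]]) (auto dest: G.wellformed')
  then show ?thesis unfolding digraph_iso_def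
    \<comment> \<open>Arcs are ordered pairs with \<open>fst\<close> and \<open>snd\<close> as tail
      and head, so the arc map is the vertex map applied to both coordinates.\<close>
    by (intro exI[of _ "\<lparr>iso_verts = f, iso_arcs = map_prod f f, iso_head = snd, iso_tail = fst\<rparr>"])
      (use inj fV fE G.wf_digraph_axioms in
        \<open>auto simp: pre_digraph.digraph_isomorphism_def app_iso_def with_proj_def\<close>)
qed

text \<open>Pigeonhole: labelled by initial segments of the naturals, graphs with fewer than
  \<open>N\<close> vertices have only finitely many codes, so two indices would share a code and
  their graphs would be isomorphic.\<close>

lemma nonisomorphic_unbounded:
  fixes \<Gamma> :: "nat \<Rightarrow> 'a pair_pre_digraph"
  assumes "\<And>n. pair_graph (\<Gamma> n)"
    and "\<And>m n. m \<noteq> n \<Longrightarrow> \<not> digraph_iso (with_proj (\<Gamma> m)) (with_proj (\<Gamma> n))"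
  shows "\<exists>n. card (pverts (\<Gamma> n)) \<ge> N"
proof (rule ccontr)
  assume "\<not> ?thesis"
  then have small: "card (pverts (\<Gamma> n)) < N" for n by (simp add: not_le)
  have wf: "pair_wf_digraph (\<Gamma> n)" and fin: "finite (pverts (\<Gamma> n))" for n
    using assms(1)[of n]
    by (auto simp: pair_graph_def pair_digraph_def pair_fin_digraph_def pair_fin_digraph_axioms_def)
  have "\<exists>g. bij_betw g (pverts (\<Gamma> n)) {0..<card (pverts (\<Gamma> n))}" for n
    using ex_bij_betw_finite_nat[OF fin] .
  then obtain g where g: "bij_betw (g n) (pverts (\<Gamma> n)) {0..<card (pverts (\<Gamma> n))}" for n
    by metis
  let ?code = "\<lambda>n. (g n ` pverts (\<Gamma> n), map_prod (g n) (g n) ` parcs (\<Gamma> n))"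
  have img: "g n ` pverts (\<Gamma> n) \<subseteq> {0..<N}" for n
    using g[of n] small[of n] by (auto simp: bij_betw_def)
  have "map_prod (g n) (g n) ` parcs (\<Gamma> n) \<subseteq> {0..<N} \<times> {0..<N}" for n
    using img[of n] pair_wf_digraph.wellformed'[OF wf[of n]] by fastforce
  then have "range ?code \<subseteq> Pow {0..<N} \<times> Pow ({0..<N} \<times> {0..<N})"
    using img by blast
  then have "finite (range ?code)" by (rule finite_subset) simp
  then have "\<not> inj ?code" using finite_imageD infinite_UNIV_nat by blast
  then obtain m n where mn: "m \<noteq> n" "?code m = ?code n" unfolding inj_def by blast
  then have "digraph_iso (with_proj (\<Gamma> m)) (with_proj (\<Gamma> n))"
    using g[of m] g[of n] wf by (intro digraph_iso_with_proj[of _ _ "g m" "g n"]) (auto simp: bij_betw_def)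
  with assms(2) mn(1) show False by blast
qed

section \<open>Assembling expanders and passing to the limit\<close>

lemma expander_from_large_graphs:
  assumes "\<epsilon> > 0"
    and "\<And>k. \<exists>\<Gamma>. pair_graph \<Gamma> \<and> P \<Gamma> \<and> card (pverts \<Gamma>) \<ge> k \<and> cheeger \<Gamma> \<ge> \<epsilon>"
  shows "\<exists>\<Gamma> :: nat \<Rightarrow> 'a pair_pre_digraph. expander \<epsilon> \<Gamma> \<and> (\<forall>n. P (\<Gamma> n))"
proof -
  let ?Q = "\<lambda>\<Gamma>. pair_graph \<Gamma> \<and> P \<Gamma> \<and> card (pverts \<Gamma>) \<ge> 2 \<and> cheeger \<Gamma> \<ge> \<epsilon>"
  \<comment> \<open>Each graph is chosen strictly larger than its predecessor; isomorphic graphs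
    have equally many vertices, so the sequence is pairwise non-isomorphic.\<close>
  have "\<exists>\<Gamma> :: nat \<Rightarrow> 'a pair_pre_digraph. \<forall>n. ?Q (\<Gamma> n) \<and>
      card (pverts (\<Gamma> n)) < card (pverts (\<Gamma> (Suc n)))"
  proof (rule dependent_nat_choice)
    show "\<exists>\<Gamma>. ?Q \<Gamma>" using assms(2)[of 2] by blast
  next
    fix G :: "'a pair_pre_digraph" and n :: nat
    assume "?Q G"
    with assms(2)[of "Suc (card (pverts G))"]
    show "\<exists>\<Gamma>. ?Q \<Gamma> \<and> card (pverts G) < card (pverts \<Gamma>)"
      by (metis Suc_le_eq le_trans less_imp_le)
  qed
  then obtain \<Gamma> :: "nat \<Rightarrow> 'a pair_pre_digraph" where \<Gamma>: "\<And>n. ?Q (\<Gamma> n)"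
    and mono: "strict_mono (\<lambda>n. card (pverts (\<Gamma> n)))"
    by (auto simp: strict_mono_Suc_iff)
  have "\<not> digraph_iso (with_proj (\<Gamma> m)) (with_proj (\<Gamma> n))" if "m \<noteq> n" for m n
    using strict_mono_eq[OF mono, of m n] that digraph_iso_card_verts by fastforce
  then show ?thesis using \<Gamma> assms(1) by (intro exI[of _ \<Gamma>]) (auto simp: expander_def)
qed

text \<open>A graph cannot have a cut larger than its vertex count, so a profile value of at least
  \<open>e * n\<close> is realized by a subgraph with at least that many vertices. Halving
  \<open>e\<close> supplies the strict inequality that \<open>expander_subgraph_if_large_cut\<close>
  requires.\<close>

lemma expander_if_sep_profile_linear:
  fixes X :: "'a pair_pre_digraph"
  assumes "pair_wf_digraph X" "e > 0"
    and "\<And>N. \<exists>n\<ge>N. real (sep_profile X n) \<ge> e * real n"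
  shows "\<exists>\<Gamma> :: nat \<Rightarrow> 'a pair_pre_digraph.
    expander (e/2) \<Gamma> \<and> (\<forall>n. subgraph (with_proj (\<Gamma> n)) (with_proj X))"
proof (rule expander_from_large_graphs)
  show "e / 2 > 0" using assms(2) by simp
  fix k :: nat
  \<comment> \<open>This bound makes \<open>e * n\<close> at least \<open>2 * (k + 1)\<close>. The
    realizing graph then has at least that many vertices, and its expanding subgraph, keeping more
    than half, has at least \<open>k\<close>.\<close>
  obtain n where n: "n \<ge> nat \<lceil>2 * real (k + 1) / e\<rceil>" "real (sep_profile X n) \<ge> e * real n"
    using assms(3) by blast
  then have "2 * real (k + 1) / e \<le> real n" by linarith
  then have large: "2 * real (k + 1) \<le> e * real n"
    using assms(2) by (simp add: field_simps)
  obtain \<Gamma> where \<Gamma>: "pair_graph \<Gamma>" "subgraph (with_proj \<Gamma>) (with_proj X)" "card (pverts \<Gamma>) \<le> n"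
    "sep_profile X n = cut_size \<Gamma>"
    using sep_profile_attained[OF assms(1)] by metis
  interpret pair_graph \<Gamma> by fact
  have "cut_size \<Gamma> \<le> card (pverts \<Gamma>)" by (rule cut_size_le_card[OF pair_finite_verts])
  then have big: "real (card (pverts \<Gamma>)) \<ge> 2 * real (k + 1)" using n(2) \<Gamma>(4) large by linarith
  have "e / 2 * real (card (pverts \<Gamma>)) < e * real (card (pverts \<Gamma>))"
    using big assms(2) by simp
  also have "\<dots> \<le> e * real n" using \<Gamma>(3) assms(2) by simp
  also have "\<dots> \<le> real (cut_size \<Gamma>)" using n(2) \<Gamma>(4) by simp
  finally have cut: "e / 2 * real (card (pverts \<Gamma>)) < real (cut_size \<Gamma>)" .
  have "card (pverts \<Gamma>) \<ge> 2" using big by simp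
  with \<open>e / 2 > 0\<close> cut obtain \<Gamma>' where \<Gamma>': "pair_graph \<Gamma>'" "subgraph (with_proj \<Gamma>') (with_proj \<Gamma>)"
    "real (card (pverts \<Gamma>')) > real (card (pverts \<Gamma>)) / 2" "cheeger \<Gamma>' \<ge> e / 2"
    using expander_subgraph_if_large_cut[OF \<Gamma>(1)] by (metis less_imp_le)
  have "subgraph (with_proj \<Gamma>') (with_proj X)" using \<Gamma>'(2) \<Gamma>(2) by (rule subgraph_trans)
  moreover have "card (pverts \<Gamma>') \<ge> k" using \<Gamma>'(3) big by simp
  ultimately show "\<exists>\<Gamma>. pair_graph \<Gamma> \<and> subgraph (with_proj \<Gamma>) (with_proj X)
      \<and> card (pverts \<Gamma>) \<ge> k \<and> cheeger \<Gamma> \<ge> e / 2"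
    using \<Gamma>' by blast
qed

lemma sep_profile_linear_if_expander:
  assumes "expander \<epsilon> \<Gamma>" "\<And>n. subgraph (with_proj (\<Gamma> n)) (with_proj X)"
  shows "\<exists>n\<ge>N. real (sep_profile X n) / real n \<ge> min (3/4) (\<epsilon>/4)"
proof -
  have \<Gamma>: "\<epsilon> > 0" "pair_graph (\<Gamma> n)" "card (pverts (\<Gamma> n)) \<ge> 2" "cheeger (\<Gamma> n) \<ge> \<epsilon>"
    and "m \<noteq> n \<Longrightarrow> \<not> digraph_iso (with_proj (\<Gamma> m)) (with_proj (\<Gamma> n))" for m n
    using assms(1) by (auto simp: expander_def)
  then obtain k where k: "card (pverts (\<Gamma> k)) \<ge> N" using nonisomorphic_unbounded by meson
  \<comment> \<open>Evaluating the profile at the exact size of a member makes that member eligible,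
    with its linear cut measured against the same number.\<close>
  let ?n = "card (pverts (\<Gamma> k))"
  have "min (3/4) (\<epsilon>/4) * real ?n \<le> real (cut_size (\<Gamma> k))"
    using cut_size_ge_cheeger \<Gamma> by blast
  also have "\<dots> \<le> real (sep_profile X ?n)"
    using cut_size_le_sep_profile[OF \<Gamma>(2) assms(2)] by simp
  finally have "min (3/4) (\<epsilon>/4) \<le> real (sep_profile X ?n) / real ?n"
    using \<Gamma>(3)[of k] by (subst pos_le_divide_eq) auto
  with k show ?thesis by blast
qed

theorem theorem1p3:
  fixes X :: "'a pair_pre_digraph"
  assumes "pair_bidirected_digraph X"
  shows "\<not> (\<lambda>n. real (sep_profile X n) / real n) \<longlonglongrightarrow> 0 \<longleftrightarrow>
    (\<exists>\<epsilon>>0. \<exists>\<Gamma> :: nat \<Rightarrow> 'a pair_pre_digraph.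
       expander \<epsilon> \<Gamma> \<and> (\<forall>n. subgraph (with_proj (\<Gamma> n)) (with_proj X)))"
proof
  interpret pair_bidirected_digraph X by fact
  assume "\<not> (\<lambda>n. real (sep_profile X n) / real n) \<longlonglongrightarrow> 0"
  \<comment> \<open>The ratio is nonnegative, so its distance to 0 is the ratio itself, which is at
    least \<open>e\<close> at arbitrarily large indices.\<close>
  then obtain e where e: "e > 0" and
    f: "\<And>N. \<exists>n\<ge>N. \<not> real (sep_profile X n) / real n < e"
    unfolding lim_sequentially by (auto simp: dist_real_def)
  have "\<exists>n\<ge>N. real (sep_profile X n) \<ge> e * real n" for N
  proof -
    obtain n where n: "n \<ge> N" "real (sep_profile X n) / real n \<ge> e"
      using f by (meson not_less)
    \<comment> \<open>Division by zero gives 0, which is below \<open>e\<close>, so index 0 is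
      excluded.\<close>
    then have "n > 0" using e by (intro Suc_leI gr0I) auto
    with n show ?thesis by (auto simp: field_simps)
  qed
  then show "\<exists>\<epsilon>>0. \<exists>\<Gamma> :: nat \<Rightarrow> 'a pair_pre_digraph.
       expander \<epsilon> \<Gamma> \<and> (\<forall>n. subgraph (with_proj (\<Gamma> n)) (with_proj X))"
    using expander_if_sep_profile_linear[OF pair_wf_digraph_axioms e]
    by (metis e half_gt_zero)
next
  assume "\<exists>\<epsilon>>0. \<exists>\<Gamma> :: nat \<Rightarrow> 'a pair_pre_digraph.
       expander \<epsilon> \<Gamma> \<and> (\<forall>n. subgraph (with_proj (\<Gamma> n)) (with_proj X))"
  then obtain \<epsilon> and \<Gamma> :: "nat \<Rightarrow> 'a pair_pre_digraph" where "\<epsilon> > 0" "expander \<epsilon> \<Gamma>"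
    "\<And>n. subgraph (with_proj (\<Gamma> n)) (with_proj X)" by blast
  then have lower: "\<exists>n\<ge>N. real (sep_profile X n) / real n \<ge> min (3/4) (\<epsilon>/4)" for N
    using sep_profile_linear_if_expander by blast
  show "\<not> (\<lambda>n. real (sep_profile X n) / real n) \<longlonglongrightarrow> 0"
  proof
    assume "(\<lambda>n. real (sep_profile X n) / real n) \<longlonglongrightarrow> 0"
    moreover have "min (3/4) (\<epsilon>/4) > 0" using \<open>\<epsilon> > 0\<close> by simp
    ultimately have "eventually (\<lambda>n. real (sep_profile X n) / real n < min (3/4) (\<epsilon>/4)) sequentially"
      by (rule order_tendstoD(2))
    then obtain N where "\<And>n. n \<ge> N \<Longrightarrow> real (sep_profile X n) / real n < min (3/4) (\<epsilon>/4)"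
      unfolding eventually_sequentially by blast
    with lower[of N] show False by (meson not_less)
  qed
qed

end
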